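(* Let $\mathbb{T}$ be a bounded time scale with at least three points, and let $n\ge 1$ be an integer. Let $L:\mathbb{R}^n\times\mathbb{R}^n\times\mathbb{T}^\kappa\to\mathbb{R}$, $(x,v,t)\mapsto L(x,v,t)$, be a Lagrangian, i.e. a continuous map of class $C^1$ in its first two variables. Assume that the forward jump operator $\sigma$ is $\nabla$-differentiable on $\mathbb{T}_\kappa$ and let $\Phi$ be a one-parameter family of infinitesimal transformations of $\mathbb{R}^n$. Consider the equation $$\left[\frac{\partial L}{\partial v}(u,u^\Delta,\cdot)\right]^\nabla(t)=\sigma^\nabla(t)\,\frac{\partial L}{\partial x}(u(t),u^\Delta(t),t)\quad\text{for every } t\in\mathbb{T}^\kappa_\kappa. \qquad (E)$$ If $L$ is invariant under the action of $\Phi$, then for every solution $u$ of $(E)$ there exists $c\in\mathbb{R}$ such that $$\frac{\partial L}{\partial v}(u(t),u^\Delta(t),t)\cdot\frac{\partial\Phi}{\partial\theta}(0,u(\sigma(t)))=c\qquad\text{for every } t\in\mathbb{T}^\kappa .$$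
   Context: A time scale is a nonempty closed subset $\mathbb{T}$ of $\mathbb{R}$; here it is bounded, $a=\min\mathbb{T}$, $b=\max\mathbb{T}$, $\mathrm{card}(\mathbb{T})\ge 3$. Jump operators $\rho,\sigma:\mathbb{T}\to\mathbb{T}$: $\rho(t)=\sup\{s\in\mathbb{T}: s<t\}$, $\sigma(t)=\inf\{s\in\mathbb{T}: s>t\}$, with $\sup\emptyset=a$ and $\inf\emptyset=b$. A point $t$ is right-dense if $t\ne b$ and $\sigma(t)=t$; it is left-dense if $t\neq a$ and $\rho(t)=t$. Set $\mathbb{T}^\kappa=\mathbb{T}\setminus(\rho(b),b]$, $\mathbb{T}_\kappa=\mathbb{T}\setminus[a,\sigma(a))$, $\mathbb{T}^\kappa_\kappa=\mathbb{T}^\kappa\cap\mathbb{T}_\kappa$. A function $u:\mathbb{T}\to\mathbb{R}^n$ is $\Delta$-differentiable at $t\in\mathbb{T}^\kappa$ if $u^\Delta(t)=\lim_{s\to t,\ s\ne\sigma(t)}\frac{u(\sigma(t))-u(s)}{\sigma(t)-s}$ exists in $\mathbb{R}^n$, and $\nabla$-differentiable at $t\in\mathbb{T}_\kappa$ if $u^\nabla(t)=\lim_{s\to t,\ s\ne\rho(t)}\frac{u(s)-u(\rho(t))}{s-\rho(t)}$ exists in $\mathbb{R}^n$. In these limits $s$ ranges over $\mathbb{T}$, and $s=t$ is allowed when $t\neq\sigma(t)$ (resp. $t\neq\rho(t)$). A function is rd-continuous if it is continuous at every right-dense point and has a left-sided limit at every left-dense point. $C^{1,\Delta}_{\mathrm{rd}}(\mathbb{T})$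 is the space of functions $\mathbb{T}\to\mathbb{R}^n$ that are $\Delta$-differentiable on $\mathbb{T}^\kappa$ with rd-continuous $\Delta$-derivative. $\frac{\partial L}{\partial v}(u,u^\Delta,\cdot)$ denotes the function $t\mapsto\frac{\partial L}{\partial v}(u(t),u^\Delta(t),t)$, defined on $\mathbb{T}^\kappa$; its $\nabla$-derivative at $t\in\mathbb{T}^\kappa_\kappa$ is defined by the limit above with $s$ ranging over $\mathbb{T}^\kappa$. A solution of $(E)$ is a function $u\in C^{1,\Delta}_{\mathrm{rd}}(\mathbb{T})$ for which this function is $\nabla$-differentiable at every $t\in\mathbb{T}^\kappa_\kappa$ and the equality $(E)$ holds there. A one-parameter family of infinitesimal transformations of $\mathbb{R}^n$ is a map $\Phi:[-\eta,\eta]\times\mathbb{R}^n\to\mathbb{R}^n$, $(\theta,x)\mapsto\Phi(\theta,x)$, of class $C^2$, for some $\eta>0$, with $\Phi(0,\cdot)=\mathrm{Id}_{\mathbb{R}^n}$. $L$ is invariant under the action of $\Phi$ if for every solution $u$ of $(E)$ and every $t\in\mathbb{T}^\kappa_\kappa$, the map $\theta\mapsto L\big(\Phi(\theta,u(t)),\Phi(\theta,u)^\Delta(t),t\big)$ has null derivative at $\theta=0$, where $\Phi(\theta,u)^\Delta(t)$ is the $\Delta$-derivative at $t$ of the function $s\mapsto\Phi(\theta,u(s))$. The dot denotes the Euclidean inner product of $\mathbb{R}^n$. *)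

theory Defs
  imports "HOL-Analysis.Analysis"
begin

section \<open>Time scales\<close>

text \<open>
  Functions on a time scale \<open>T\<close> (or on a subset of it) are total functions on the reals; every
  notion below only looks at their values on the intended domain.
\<close>

definition time_scale :: "real set \<Rightarrow> bool" where
  "time_scale T \<longleftrightarrow> closed T \<and> T \<noteq> {}"

text \<open>For a nonempty compact \<open>T\<close>, \<open>Inf T\<close> and \<open>Sup T\<close> are its minimum and maximum.\<close>

definition fwd_jump :: "real set \<Rightarrow> real \<Rightarrow> real" where
  "fwd_jump T t = (if \<exists>s\<in>T. s > t then Inf {s \<in> T. s > t} else Sup T)"

definition bwd_jump :: "real set \<Rightarrow> real \<Rightarrow> real" where
  "bwd_jump T t = (if \<exists>s\<in>T. s < t then Sup {s \<in> T. s < t} else Inf T)"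

definition right_dense :: "real set \<Rightarrow> real \<Rightarrow> bool" where
  "right_dense T t \<longleftrightarrow> t \<in> T \<and> t \<noteq> Sup T \<and> fwd_jump T t = t"

definition left_dense :: "real set \<Rightarrow> real \<Rightarrow> bool" where
  "left_dense T t \<longleftrightarrow> t \<in> T \<and> t \<noteq> Inf T \<and> bwd_jump T t = t"

definition upper_kappa :: "real set \<Rightarrow> real set" where
  "upper_kappa T = T - {bwd_jump T (Sup T)<..Sup T}"

definition lower_kappa :: "real set \<Rightarrow> real set" where
  "lower_kappa T = T - {Inf T..<fwd_jump T (Inf T)}"


section \<open>Delta and nabla derivatives\<close>

text \<open>
  The filter is not \<open>at t within T\<close>: the excluded point is the jump point, and \<open>s = t\<close> is
  admitted whenever \<open>t\<close> differs from it.
\<close>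

definition has_delta_derivative ::
    "real set \<Rightarrow> (real \<Rightarrow> 'a::real_normed_vector) \<Rightarrow> 'a \<Rightarrow> real \<Rightarrow> bool" where
  "has_delta_derivative T f d t \<longleftrightarrow>
     ((\<lambda>s. (f (fwd_jump T t) - f s) /\<^sub>R (fwd_jump T t - s)) \<longlongrightarrow> d)
       (inf (nhds t) (principal (T - {fwd_jump T t})))"

definition delta_differentiable ::
    "real set \<Rightarrow> (real \<Rightarrow> 'a::real_normed_vector) \<Rightarrow> real \<Rightarrow> bool" where
  "delta_differentiable T f t \<longleftrightarrow> (\<exists>d. has_delta_derivative T f d t)"

definition delta_deriv :: "real set \<Rightarrow> (real \<Rightarrow> 'a::real_normed_vector) \<Rightarrow> real \<Rightarrow> 'a" where
  "delta_deriv T f t = (THE d. has_delta_derivative T f d t)"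

text \<open>
  In the nabla derivative of \<open>f\<close>, the set \<open>D \<subseteq> T\<close> is the domain of \<open>f\<close>, over which \<open>s\<close> ranges,
  while the jump operator is that of \<open>T\<close>.
\<close>

definition has_nabla_derivative ::
    "real set \<Rightarrow> real set \<Rightarrow> (real \<Rightarrow> 'a::real_normed_vector) \<Rightarrow> 'a \<Rightarrow> real \<Rightarrow> bool" where
  "has_nabla_derivative T D f d t \<longleftrightarrow>
     ((\<lambda>s. (f s - f (bwd_jump T t)) /\<^sub>R (s - bwd_jump T t)) \<longlongrightarrow> d)
       (inf (nhds t) (principal (D - {bwd_jump T t})))"

definition nabla_differentiable ::
    "real set \<Rightarrow> real set \<Rightarrow> (real \<Rightarrow> 'a::real_normed_vector) \<Rightarrow> real \<Rightarrow> bool" where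
  "nabla_differentiable T D f t \<longleftrightarrow> (\<exists>d. has_nabla_derivative T D f d t)"

definition nabla_deriv ::
    "real set \<Rightarrow> real set \<Rightarrow> (real \<Rightarrow> 'a::real_normed_vector) \<Rightarrow> real \<Rightarrow> 'a" where
  "nabla_deriv T D f t = (THE d. has_nabla_derivative T D f d t)"

definition rd_continuous ::
    "real set \<Rightarrow> real set \<Rightarrow> (real \<Rightarrow> 'a::topological_space) \<Rightarrow> bool" where
  "rd_continuous T D f \<longleftrightarrow>
     (\<forall>t\<in>D. (right_dense T t \<longrightarrow> continuous (at t within D) f) \<and>
            (left_dense T t \<longrightarrow> (\<exists>l. (f \<longlongrightarrow> l) (at t within (D \<inter> {..<t})))))"

definition C1_delta_rd :: "real set \<Rightarrow> (real \<Rightarrow> 'a::real_normed_vector) set" where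
  "C1_delta_rd T = {u. (\<forall>t\<in>upper_kappa T. delta_differentiable T u t) \<and>
                       rd_continuous T (upper_kappa T) (delta_deriv T u)}"


section \<open>Classes \<open>C\<^sup>1\<close> and \<open>C\<^sup>2\<close>, gradients\<close>

text \<open>
  Derivatives are taken within \<open>S\<close>, which covers the boundary points of \<open>[-\<eta>, \<eta>] \<times> \<real>\<^sup>n\<close>.
\<close>

definition C1_on :: "('a::real_normed_vector \<Rightarrow> 'b::real_normed_vector) \<Rightarrow> 'a set \<Rightarrow> bool" where
  "C1_on f S \<longleftrightarrow> (\<exists>f' :: 'a \<Rightarrow> 'a \<Rightarrow>\<^sub>L 'b.
     (\<forall>x\<in>S. (f has_derivative blinfun_apply (f' x)) (at x within S)) \<and> continuous_on S f')"

definition C2_on :: "('a::real_normed_vector \<Rightarrow> 'b::real_normed_vector) \<Rightarrow> 'a set \<Rightarrow> bool" where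
  "C2_on f S \<longleftrightarrow> (\<exists>f' :: 'a \<Rightarrow> 'a \<Rightarrow>\<^sub>L 'b.
     (\<forall>x\<in>S. (f has_derivative blinfun_apply (f' x)) (at x within S)) \<and> C1_on f' S)"

definition gradient :: "('a::real_inner \<Rightarrow> real) \<Rightarrow> 'a \<Rightarrow> 'a" where
  "gradient f x = (THE D. GDERIV f x :> D)"


section \<open>Lagrangians, the Euler-Lagrange equation, and invariance\<close>

definition lagrangian ::
    "real set \<Rightarrow> (real ^ 'n \<Rightarrow> real ^ 'n \<Rightarrow> real \<Rightarrow> real) \<Rightarrow> bool" where
  "lagrangian T L \<longleftrightarrow>
     continuous_on (UNIV \<times> UNIV \<times> upper_kappa T) (\<lambda>(x, v, t). L x v t) \<and>
     (\<forall>t\<in>upper_kappa T. C1_on (\<lambda>(x, v). L x v t) UNIV)"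

definition dL_dx ::
    "(real ^ 'n \<Rightarrow> real ^ 'n \<Rightarrow> real \<Rightarrow> real) \<Rightarrow> real ^ 'n \<Rightarrow> real ^ 'n \<Rightarrow> real \<Rightarrow> real ^ 'n" where
  "dL_dx L x v t = gradient (\<lambda>y. L y v t) x"

definition dL_dv ::
    "(real ^ 'n \<Rightarrow> real ^ 'n \<Rightarrow> real \<Rightarrow> real) \<Rightarrow> real ^ 'n \<Rightarrow> real ^ 'n \<Rightarrow> real \<Rightarrow> real ^ 'n" where
  "dL_dv L x v t = gradient (\<lambda>w. L x w t) v"

definition EL_solution ::
    "real set \<Rightarrow> (real ^ 'n \<Rightarrow> real ^ 'n \<Rightarrow> real \<Rightarrow> real) \<Rightarrow> (real \<Rightarrow> real ^ 'n) \<Rightarrow> bool" where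
  "EL_solution T L u \<longleftrightarrow> u \<in> C1_delta_rd T \<and>
     (\<forall>t \<in> upper_kappa T \<inter> lower_kappa T.
        nabla_differentiable T (upper_kappa T) (\<lambda>s. dL_dv L (u s) (delta_deriv T u s) s) t \<and>
        nabla_deriv T (upper_kappa T) (\<lambda>s. dL_dv L (u s) (delta_deriv T u s) s) t =
          nabla_deriv T T (fwd_jump T) t *\<^sub>R dL_dx L (u t) (delta_deriv T u t) t)"

definition infinitesimal_transformations ::
    "real \<Rightarrow> (real \<times> (real ^ 'n) \<Rightarrow> real ^ 'n) \<Rightarrow> bool" where
  "infinitesimal_transformations \<eta> \<Phi> \<longleftrightarrow>
     \<eta> > 0 \<and> C2_on \<Phi> ({-\<eta>..\<eta>} \<times> UNIV) \<and> (\<forall>x. \<Phi> (0, x) = x)"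

text \<open>
  Since \<open>0\<close> is interior to \<open>[-\<eta>, \<eta>]\<close>, the derivatives at \<open>\<theta> = 0\<close> do not see the values of
  \<open>\<Phi>\<close> outside its domain.
\<close>

definition invariant_under ::
    "real set \<Rightarrow> (real ^ 'n \<Rightarrow> real ^ 'n \<Rightarrow> real \<Rightarrow> real) \<Rightarrow> (real \<times> (real ^ 'n) \<Rightarrow> real ^ 'n) \<Rightarrow> bool" where
  "invariant_under T L \<Phi> \<longleftrightarrow>
     (\<forall>u. EL_solution T L u \<longrightarrow>
        (\<forall>t \<in> upper_kappa T \<inter> lower_kappa T.
           ((\<lambda>\<theta>. L (\<Phi> (\<theta>, u t)) (delta_deriv T (\<lambda>s. \<Phi> (\<theta>, u s)) t) t)
              has_real_derivative 0) (at 0)))"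

definition dPhi_dtheta0 :: "(real \<times> (real ^ 'n) \<Rightarrow> real ^ 'n) \<Rightarrow> real ^ 'n \<Rightarrow> real ^ 'n" where
  "dPhi_dtheta0 \<Phi> x = vector_derivative (\<lambda>\<theta>. \<Phi> (\<theta>, x)) (at 0)"

end

theory Submission
  imports Defs
begin

text \<open>
  Write \<open>p\<close> for the momentum \<open>\<partial>L/\<partial>v\<close> along a solution \<open>u\<close>, \<open>q\<close> for \<open>\<partial>L/\<partial>x\<close> along \<open>u\<close>, and \<open>w\<close> for
  the generator \<open>\<partial>\<Phi>/\<partial>\<theta>(0, \<cdot>)\<close>. As in Noether's classical argument, invariance differentiated at
  \<open>\<theta> = 0\<close> gives the pointwise identity \<open>q \<bullet> w(u) + p \<bullet> (w \<circ> u)\<^sup>\<Delta> = 0\<close>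
  (\<open>infinitesimal_invariance\<close>). This needs \<open>\<partial>/\<partial>\<theta>\<close> to commute with the delta derivative
  (\<open>delta_deriv_transformation\<close>), which at a right-dense point is the symmetry of the second
  derivative of \<open>\<Phi>\<close> and at a right-scattered point is linearity.

  The conserved quantity is \<open>F(t) = p(t) \<bullet> w(u(\<sigma>(t)))\<close>, with the jump \<open>\<sigma>\<close> inside. Its nabla
  derivative is computed by a product rule and a chain rule, and by the Euler-Lagrange equation it
  equals \<open>\<sigma>\<^sup>\<nabla>(t)\<close> times the left-hand side of the identity above
  (\<open>conserved_quantity_nabla_zero\<close>). Two consequences of the nabla differentiability of \<open>\<sigma>\<close> make
  this work. First, \<open>\<sigma>\<close> is continuous, so a left-dense point is never right-scattered
  (\<open>left_dense_fwd_jump_fixed\<close>): at such a point both jumps are trivial and the computation is the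
  classical one. Second, at a left-scattered point \<open>\<sigma>(\<rho>(t)) = t\<close>, hence \<open>\<sigma>(t) - t\<close> is
  \<open>(t - \<rho>(t)) \<sigma>\<^sup>\<nabla>(t)\<close>, which converts the backward increment of \<open>p\<close> and the forward increment
  of \<open>w \<circ> u\<close> into multiples of one another.

  Finally, a continuous function whose nabla derivative vanishes is constant
  (\<open>nabla_zero_imp_constant\<close>), by a first-point argument that looks only to the left and
  therefore suits the nabla derivative at points of every kind.
\<close>

section \<open>Symmetry of the second derivative\<close>

text \<open>
  The second-order increment over the parallelogram spanned by \<open>s h\<close> and \<open>s k\<close> is symmetric in
  \<open>h\<close> and \<open>k\<close>. Read as the increment along \<open>h\<close> of the function \<open>y \<mapsto> f (y + s k) - f y\<close>, it is
  \<open>s\<^sup>2 A k h + o(s\<^sup>2)\<close> by the mean value inequality; exchanging the roles of \<open>h\<close> and \<open>k\<close> gives the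
  limit \<open>A h k\<close> instead.
\<close>
lemma second_derivative_symmetric:
  fixes f :: "'a::real_normed_vector \<Rightarrow> 'b::real_normed_vector"
    and f' :: "'a \<Rightarrow> 'a \<Rightarrow>\<^sub>L 'b" and A :: "'a \<Rightarrow> 'a \<Rightarrow>\<^sub>L 'b"
  assumes f: "\<forall>\<^sub>F y in nhds x. (f has_derivative f' y) (at y)"
    and f': "(f' has_derivative A) (at x)"
  shows "A h k = A k h"
proof -
  define R where "R s = f (x + s *\<^sub>R h + s *\<^sub>R k) - f (x + s *\<^sub>R h) - f (x + s *\<^sub>R k) + f x" for s :: real
  interpret A: bounded_linear A
    using f' by (rule has_derivative_bounded_linear)
  have key: "((\<lambda>s. R s /\<^sub>R s\<^sup>2) \<longlongrightarrow> A k h) (at_right 0)"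
    if R: "\<And>s. R s = (f (x + s *\<^sub>R h + s *\<^sub>R k) - f (x + s *\<^sub>R h)) - (f (x + s *\<^sub>R k) - f x)"
    for h k
  proof (rule tendstoI)
    fix e :: real assume "e > 0"
    \<comment> \<open>\<open>N\<close> bounds the size of the parallelogram; \<open>\<epsilon>\<close> is chosen so that the final error is \<open>s\<^sup>2 e / 2\<close>.\<close>
    define N where "N = norm h + norm k + 1"
    have N: "N > 0" "norm h \<le> N" "norm k \<le> N" "norm h + norm k \<le> N"
      by (auto simp: N_def add_nonneg_pos)
    define \<epsilon> where "\<epsilon> = e / (4 * N * N)"
    have "\<epsilon> > 0" using \<open>e > 0\<close> N by (simp add: \<epsilon>_def)
    obtain r1 where r1: "r1 > 0" "\<And>y. dist y x < r1 \<Longrightarrow> (f has_derivative f' y) (at y)"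
      using f unfolding eventually_nhds_metric by blast
    obtain r2 where r2: "r2 > 0"
      "\<And>y. norm (y - x) < r2 \<Longrightarrow> norm (f' y - f' x - A (y - x)) \<le> \<epsilon> * norm (y - x)"
      using f' \<open>\<epsilon> > 0\<close> unfolding has_derivative_at_alt by blast
    define r where "r = min r1 r2 / N"
    have "r > 0" using r1 r2 N by (simp add: r_def)
    have "norm (R s /\<^sub>R s\<^sup>2 - A k h) < e" if s: "0 < s" "s < r" for s
    proof -
      have sN: "s * N < r1" "s * N < r2" using s N by (auto simp: r_def pos_less_divide_eq)
      have small: "norm (c *\<^sub>R (s *\<^sub>R h) + d *\<^sub>R (s *\<^sub>R k)) \<le> s * N"
        if "c \<in> {0..1}" "d \<in> {0..1}" for c d
      proof -
        have "norm (c *\<^sub>R (s *\<^sub>R h) + d *\<^sub>R (s *\<^sub>R k)) \<le> c * (s * norm h) + d * (s * norm k)"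
          using norm_triangle_ineq[of "c *\<^sub>R (s *\<^sub>R h)" "d *\<^sub>R (s *\<^sub>R k)"] that s by simp
        also have "\<dots> \<le> 1 * (s * norm h) + 1 * (s * norm k)"
          using that s by (intro add_mono mult_right_mono) auto
        also have "\<dots> \<le> s * N" using N s by (simp add: distrib_left[symmetric])
        finally show ?thesis .
      qed
      \<comment> \<open>The expected linear part is subtracted, so that a bound on the derivative of \<open>g\<close> is an error bound.\<close>
      define g where "g y = f (y + s *\<^sub>R k) - f y - s *\<^sub>R (A k) y" for y
      define G where "G = (\<lambda>c. x + c *\<^sub>R (s *\<^sub>R h)) ` {0..1}"
      define g' where "g' y = f' (y + s *\<^sub>R k) - f' y - s *\<^sub>R A k" for y
      have g: "(g has_derivative g' y) (at y within G)" if "y \<in> G" for y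
      proof -
        obtain c where c: "c \<in> {0..1}" "y = x + c *\<^sub>R (s *\<^sub>R h)" using \<open>y \<in> G\<close> by (auto simp: G_def)
        have "dist (y + s *\<^sub>R k) x < r1" "dist y x < r1"
          using small[OF c(1), of 1] small[OF c(1), of 0] sN by (auto simp: dist_norm c(2))
        then have *: "(f has_derivative f' (y + s *\<^sub>R k)) (at (y + s *\<^sub>R k))" "(f has_derivative f' y) (at y)"
          using r1 by auto
        have "((\<lambda>y. f (y + s *\<^sub>R k)) has_derivative (\<lambda>z. f' (y + s *\<^sub>R k) z)) (at y)"
          by (rule has_derivative_compose[where f = "\<lambda>y. y + s *\<^sub>R k" and f' = "\<lambda>z. z" and g = f, OF _ *(1)])
             (auto intro!: derivative_eq_intros)
        then have "(g has_derivative (\<lambda>z. f' (y + s *\<^sub>R k) z - f' y z - s *\<^sub>R A k z)) (at y)"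
          unfolding g_def
          by (intro has_derivative_diff has_derivative_scaleR_right *(2)
              bounded_linear.has_derivative[OF blinfun.bounded_linear_right] has_derivative_ident)
        moreover have "blinfun_apply (g' y) = (\<lambda>z. f' (y + s *\<^sub>R k) z - f' y z - s *\<^sub>R A k z)"
          by (rule ext) (simp only: g'_def minus_blinfun.rep_eq scaleR_blinfun.rep_eq)
        ultimately show ?thesis
          by (metis has_derivative_at_withinI)
      qed
      have B: "onorm (g' (x + c *\<^sub>R (s *\<^sub>R h))) \<le> 2 * \<epsilon> * (s * N)" if c: "c \<in> {0..1}" for c
      proof -
        let ?y = "x + c *\<^sub>R (s *\<^sub>R h)"
        let ?p = "f' (?y + s *\<^sub>R k) - f' x - A (?y + s *\<^sub>R k - x)" and ?q = "f' ?y - f' x - A (?y - x)"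
        have "g' ?y = ?p - ?q"
          by (simp add: g'_def A.diff A.add A.scaleR)
        moreover have "norm ?p \<le> \<epsilon> * (s * N)"
        proof -
          have "norm (?y + s *\<^sub>R k - x) \<le> s * N" using small[OF c, of 1] by simp
          moreover from this have "norm ?p \<le> \<epsilon> * norm (?y + s *\<^sub>R k - x)" using sN by (intro r2) auto
          ultimately show ?thesis using \<open>\<epsilon> > 0\<close> by (smt (verit) mult_left_mono)
        qed
        moreover have "norm ?q \<le> \<epsilon> * (s * N)"
        proof -
          have "norm (?y - x) \<le> s * N" using small[OF c, of 0] by simp
          moreover from this have "norm ?q \<le> \<epsilon> * norm (?y - x)" using sN by (intro r2) auto
          ultimately show ?thesis using \<open>\<epsilon> > 0\<close> by (smt (verit) mult_left_mono)
        qed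
        ultimately have "norm (g' ?y) \<le> 2 * \<epsilon> * (s * N)"
          using norm_triangle_ineq4[of ?p ?q] by simp
        then show ?thesis by (simp add: norm_blinfun.rep_eq)
      qed
      have "norm (g (x + s *\<^sub>R h) - g x) \<le> norm (s *\<^sub>R h) * (2 * \<epsilon> * (s * N))"
        by (rule differentiable_bound_segment[OF _ g B]) (auto simp: G_def)
      also have "\<dots> \<le> (s * N) * (2 * \<epsilon> * (s * N))"
        using s N \<open>\<epsilon> > 0\<close> by (intro mult_right_mono) auto
      also have "\<dots> = s\<^sup>2 * (e / 2)" using N by (simp add: \<epsilon>_def power2_eq_square)
      finally have "norm (g (x + s *\<^sub>R h) - g x) \<le> s\<^sup>2 * (e / 2)" .
      moreover have "g (x + s *\<^sub>R h) - g x = s\<^sup>2 *\<^sub>R (R s /\<^sub>R s\<^sup>2 - A k h)"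
      proof -
        have "g (x + s *\<^sub>R h) - g x = R s - s *\<^sub>R (A k (x + s *\<^sub>R h) - A k x)"
          unfolding g_def R scaleR_diff_right by simp
        also have "\<dots> = R s - s\<^sup>2 *\<^sub>R A k h"
          by (simp add: blinfun.add_right blinfun.scaleR_right power2_eq_square)
        also have "\<dots> = s\<^sup>2 *\<^sub>R (R s /\<^sub>R s\<^sup>2 - A k h)"
          using s by (simp add: scaleR_diff_right)
        finally show ?thesis .
      qed
      ultimately have "s\<^sup>2 * norm (R s /\<^sub>R s\<^sup>2 - A k h) \<le> s\<^sup>2 * (e / 2)" by simp
      then have "norm (R s /\<^sub>R s\<^sup>2 - A k h) \<le> e / 2" using s by (simp add: mult_le_cancel_left)
      then show ?thesis using \<open>e > 0\<close> by linarith
    qed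
    then show "\<forall>\<^sub>F s in at_right 0. dist (R s /\<^sub>R s\<^sup>2) (A k h) < e"
      unfolding eventually_at_right_field dist_norm using \<open>r > 0\<close> by blast
  qed
  have "((\<lambda>s. R s /\<^sub>R s\<^sup>2) \<longlongrightarrow> A k h) (at_right 0)"
    by (rule key) (simp add: R_def)
  moreover have "((\<lambda>s. R s /\<^sub>R s\<^sup>2) \<longlongrightarrow> A h k) (at_right 0)"
    by (rule key) (simp add: R_def algebra_simps)
  ultimately show ?thesis
    using tendsto_unique trivial_limit_at_right_real by blast
qed

section \<open>Delta and nabla derivatives in a common form\<close>

text \<open>
  The delta and the nabla derivative are the same difference quotient, with base point \<open>\<sigma>(t)\<close> or
  \<open>\<rho>(t)\<close>. Treating the base point \<open>j\<close> as a parameter lets one set of lemmas serve both.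
\<close>
definition has_jump_derivative ::
    "real set \<Rightarrow> real \<Rightarrow> (real \<Rightarrow> 'a::real_normed_vector) \<Rightarrow> 'a \<Rightarrow> real \<Rightarrow> bool" where
  "has_jump_derivative D j f d t \<longleftrightarrow>
     ((\<lambda>s. (f s - f j) /\<^sub>R (s - j)) \<longlongrightarrow> d) (inf (nhds t) (principal (D - {j})))"

lemma has_nabla_derivative_iff_jump:
  "has_nabla_derivative T D f d t \<longleftrightarrow> has_jump_derivative D (bwd_jump T t) f d t"
  by (simp add: has_nabla_derivative_def has_jump_derivative_def)

lemma has_delta_derivative_iff_jump:
  "has_delta_derivative T f d t \<longleftrightarrow> has_jump_derivative T (fwd_jump T t) f d t"
proof -
  have "(f j - f s) /\<^sub>R (j - s) = (f s - f j) /\<^sub>R (s - j)" for j s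
  proof -
    have "(f j - f s) /\<^sub>R (j - s) = (- (f s - f j)) /\<^sub>R (- (s - j))" by simp
    also have "\<dots> = (f s - f j) /\<^sub>R (s - j)"
      by (simp only: inverse_minus_eq scaleR_minus_left scaleR_minus_right minus_minus)
    finally show ?thesis .
  qed
  then show ?thesis
    by (simp add: has_delta_derivative_def has_jump_derivative_def)
qed

lemma has_jump_derivative_dense:
  "has_jump_derivative D t f d t \<longleftrightarrow> (f has_vector_derivative d) (at t within D)"
proof -
  have "(f has_vector_derivative d) (at t within D) \<longleftrightarrow>
      ((\<lambda>s. norm (f s - f t - (s - t) *\<^sub>R d) / norm (s - t)) \<longlongrightarrow> 0) (at t within D)"
    by (simp add: has_vector_derivative_def has_derivative_iff_norm bounded_linear_scaleR_left)
  also have "\<dots> \<longleftrightarrow> ((\<lambda>s. norm ((f s - f t) /\<^sub>R (s - t) - d)) \<longlongrightarrow> 0) (at t within D)"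
  proof (rule filterlim_cong[OF refl refl])
    have "norm (f s - f t - (s - t) *\<^sub>R d) / norm (s - t) = norm ((f s - f t) /\<^sub>R (s - t) - d)"
      if "s \<noteq> t" for s
    proof -
      have "(f s - f t) /\<^sub>R (s - t) - d = (f s - f t - (s - t) *\<^sub>R d) /\<^sub>R (s - t)"
        using that by (simp add: scaleR_diff_right)
      then show ?thesis by (simp add: divide_inverse mult.commute)
    qed
    then show "\<forall>\<^sub>F s in at t within D. norm (f s - f t - (s - t) *\<^sub>R d) / norm (s - t) =
        norm ((f s - f t) /\<^sub>R (s - t) - d)"
      by (auto simp: eventually_at_filter)
  qed
  also have "\<dots> \<longleftrightarrow> has_jump_derivative D t f d t"
    by (simp add: has_jump_derivative_def at_within_def tendsto_norm_zero_iff LIM_zero_iff)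
  finally show ?thesis by simp
qed

lemma nhds_within_Diff_singleton:
  fixes t :: real assumes "j \<noteq> t"
  shows "inf (nhds t) (principal (D - {j})) = inf (nhds t) (principal D)"
proof (rule filter_eqI)
  fix P
  have "\<forall>\<^sub>F s in nhds t. s \<noteq> j" using assms by (simp add: t1_space_nhds)
  then show "eventually P (inf (nhds t) (principal (D - {j}))) = eventually P (inf (nhds t) (principal D))"
    unfolding eventually_inf_principal by (auto elim: eventually_elim2)
qed

text \<open>
  If \<open>j \<noteq> t\<close>, the filter admits \<open>s = t\<close> and the denominator stays away from zero: the limit can only
  be the value of the quotient at \<open>t\<close>, and its existence amounts to the continuity of \<open>f\<close> there.
\<close>
lemma has_jump_derivative_scattered:
  assumes t: "t \<in> D" "j \<noteq> t"
  shows "has_jump_derivative D j f d t \<longleftrightarrow>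
    continuous (at t within D) f \<and> f t - f j = (t - j) *\<^sub>R d"
proof -
  let ?F = "inf (nhds t) (principal (D - {j}))"
  have F: "?F = inf (nhds t) (principal D)" using t(2) by (rule nhds_within_Diff_singleton)
  have "(\<forall>\<^sub>F s in at t within D. f s \<in> S) \<longleftrightarrow> (\<forall>\<^sub>F s in ?F. f s \<in> S)" if "f t \<in> S" for S
    unfolding F eventually_inf_principal eventually_at_filter
    using that by (intro arg_cong[where f = "\<lambda>P. eventually P (nhds t)"] ext) auto
  then have cont: "continuous (at t within D) f \<longleftrightarrow> (f \<longlongrightarrow> f t) ?F"
    unfolding continuous_within tendsto_def by blast
  have id: "((\<lambda>s. s) \<longlongrightarrow> t) ?F" by (rule tendsto_mono[OF inf_le1]) (rule filterlim_ident)
  show ?thesis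
  proof
    assume d: "has_jump_derivative D j f d t"
    have "d = (f t - f j) /\<^sub>R (t - j)"
    proof (rule ccontr)
      assume ne: "d \<noteq> (f t - f j) /\<^sub>R (t - j)"
      then have "\<forall>\<^sub>F s in ?F. (f s - f j) /\<^sub>R (s - j) \<noteq> (f t - f j) /\<^sub>R (t - j)"
        using d unfolding has_jump_derivative_def by (intro tendsto_imp_eventually_ne)
      then show False unfolding eventually_inf_principal using t by (auto dest: eventually_nhds_x_imp_x)
    qed
    then have eq: "f t - f j = (t - j) *\<^sub>R d" using t by simp
    have "((\<lambda>s. (s - j) *\<^sub>R ((f s - f j) /\<^sub>R (s - j)) + f j) \<longlongrightarrow> (t - j) *\<^sub>R d + f j) ?F"
      using d id unfolding has_jump_derivative_def by (intro tendsto_intros)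
    moreover have "\<forall>\<^sub>F s in ?F. (s - j) *\<^sub>R ((f s - f j) /\<^sub>R (s - j)) + f j = f s"
      unfolding eventually_inf_principal by (auto intro!: always_eventually)
    ultimately have "(f \<longlongrightarrow> (t - j) *\<^sub>R d + f j) ?F" by (rule Lim_transform_eventually)
    then show "continuous (at t within D) f \<and> f t - f j = (t - j) *\<^sub>R d"
      using eq cont by (metis diff_add_cancel)
  next
    assume *: "continuous (at t within D) f \<and> f t - f j = (t - j) *\<^sub>R d"
    then have "((\<lambda>s. (f s - f j) /\<^sub>R (s - j)) \<longlongrightarrow> (f t - f j) /\<^sub>R (t - j)) ?F"
      using id t unfolding cont by (intro tendsto_intros) auto
    then show "has_jump_derivative D j f d t"
      using * t by (simp add: has_jump_derivative_def)
  qed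
qed

lemma has_jump_derivative_continuous:
  "has_jump_derivative D j f d t \<Longrightarrow> t \<in> D \<Longrightarrow> continuous (at t within D) f"
  by (metis has_jump_derivative_dense has_jump_derivative_scattered has_vector_derivative_continuous)

lemma has_jump_derivative_diff:
  "has_jump_derivative D j f d t \<Longrightarrow> t \<in> D \<Longrightarrow> f t - f j = (t - j) *\<^sub>R d"
  by (cases "j = t") (auto simp: has_jump_derivative_scattered)

lemma has_jump_derivative_unique:
  assumes "has_jump_derivative D j f d t" "has_jump_derivative D j f d' t" "t \<in> D"
    and "j = t \<Longrightarrow> t islimpt D"
  shows "d = d'"
proof (cases "j = t")
  case True
  then show ?thesis
    using assms vector_derivative_unique_within[of t D f d d']
    by (simp add: has_jump_derivative_dense trivial_limit_within)
next
  case False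
  then have "(t - j) *\<^sub>R d = (t - j) *\<^sub>R d'"
    using assms by (simp add: has_jump_derivative_scattered)
  then show ?thesis using False by simp
qed

section \<open>Jump operators on a bounded time scale\<close>

locale bounded_time_scale =
  fixes T :: "real set"
  assumes time_scale: "time_scale T" and bounded: "bounded T"
begin

lemma closed: "closed T" and nonempty: "T \<noteq> {}"
  using time_scale by (auto simp: time_scale_def)

lemma Inf_mem: "Inf T \<in> T" and Sup_mem: "Sup T \<in> T"
  using closed nonempty bounded
  by (auto intro: closed_contains_Inf closed_contains_Sup bounded_imp_bdd_below bounded_imp_bdd_above)

lemma Inf_le: "t \<in> T \<Longrightarrow> Inf T \<le> t" and le_Sup: "t \<in> T \<Longrightarrow> t \<le> Sup T"
  using bounded by (auto intro: cInf_lower cSup_upper bounded_imp_bdd_below bounded_imp_bdd_above)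

lemma bdd_above_below: "bdd_above {s \<in> T. s < t}" and bdd_below_above: "bdd_below {s \<in> T. t < s}"
  by (auto intro: bdd_aboveI[where M = t] bdd_belowI[where m = t])

lemma fwd_jump_mem: "fwd_jump T t \<in> T"
proof (cases "\<exists>s\<in>T. t < s")
  case True
  then have "Inf {s \<in> T. t < s} \<in> closure {s \<in> T. t < s}"
    by (intro closure_contains_Inf bdd_below_above) auto
  moreover have "closure {s \<in> T. t < s} \<subseteq> T"
    using closed by (intro closure_minimal) auto
  ultimately show ?thesis using True by (auto simp: fwd_jump_def)
qed (auto simp: fwd_jump_def Sup_mem)

lemma bwd_jump_mem: "bwd_jump T t \<in> T"
proof (cases "\<exists>s\<in>T. s < t")
  case True
  then have "Sup {s \<in> T. s < t} \<in> closure {s \<in> T. s < t}"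
    by (intro closure_contains_Sup bdd_above_below) auto
  moreover have "closure {s \<in> T. s < t} \<subseteq> T"
    using closed by (intro closure_minimal) auto
  ultimately show ?thesis using True by (auto simp: bwd_jump_def)
qed (auto simp: bwd_jump_def Inf_mem)

lemma fwd_jump_le: "s \<in> T \<Longrightarrow> t < s \<Longrightarrow> fwd_jump T t \<le> s"
  by (auto simp: fwd_jump_def intro!: cInf_lower bdd_below_above)

lemma fwd_jump_greatest: "s \<in> T \<Longrightarrow> t < s \<Longrightarrow> (\<And>s. s \<in> T \<Longrightarrow> t < s \<Longrightarrow> x \<le> s) \<Longrightarrow> x \<le> fwd_jump T t"
  by (auto simp: fwd_jump_def intro!: cInf_greatest)

lemma bwd_jump_ge: "s \<in> T \<Longrightarrow> s < t \<Longrightarrow> s \<le> bwd_jump T t"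
  by (auto simp: bwd_jump_def intro!: cSup_upper bdd_above_below)

lemma bwd_jump_least: "s \<in> T \<Longrightarrow> s < t \<Longrightarrow> (\<And>s. s \<in> T \<Longrightarrow> s < t \<Longrightarrow> s \<le> x) \<Longrightarrow> bwd_jump T t \<le> x"
  by (auto simp: bwd_jump_def intro!: cSup_least)

lemma fwd_jump_ge: "t \<in> T \<Longrightarrow> t \<le> fwd_jump T t"
  by (cases "\<exists>s\<in>T. t < s") (auto intro: fwd_jump_greatest le_Sup simp: fwd_jump_def intro!: cInf_greatest)

lemma bwd_jump_le: "t \<in> T \<Longrightarrow> bwd_jump T t \<le> t"
  by (cases "\<exists>s\<in>T. s < t") (auto intro: Inf_le simp: bwd_jump_def intro!: cSup_least)

text \<open>
  The gap \<open>(\<rho>(t), t)\<close> contains no point of the time scale.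
\<close>
lemma fwd_jump_bwd_jump:
  assumes "t \<in> T" "bwd_jump T t < t"
  shows "fwd_jump T (bwd_jump T t) = t"
proof (rule antisym)
  show "t \<le> fwd_jump T (bwd_jump T t)"
    using assms bwd_jump_ge by (intro fwd_jump_greatest[of t]) (auto simp: not_le[symmetric])
qed (rule fwd_jump_le[OF assms])

lemma left_dense_approx:
  assumes "t \<in> T" "bwd_jump T t = t" "Inf T < t" "x < t"
  shows "\<exists>s\<in>T. x < s \<and> s < t"
  using bwd_jump_least[OF Inf_mem \<open>Inf T < t\<close>, of x] assms by force

lemma right_dense_approx:
  assumes "t \<in> T" "fwd_jump T t = t" "t < Sup T" "t < x"
  shows "\<exists>s\<in>T. t < s \<and> s < x"
  using fwd_jump_greatest[OF Sup_mem \<open>t < Sup T\<close>, of x] assms by force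

lemma upper_kappa_eq: "upper_kappa T = T \<inter> {..bwd_jump T (Sup T)}"
  using le_Sup by (auto simp: upper_kappa_def)

lemma compact_upper_kappa: "compact (upper_kappa T)"
  unfolding upper_kappa_eq using closed bounded
  by (auto simp: compact_eq_bounded_closed intro: bounded_subset)

lemma upper_kappa_subset: "upper_kappa T \<subseteq> T"
  by (auto simp: upper_kappa_def)

lemma less_Sup_upper_kappa: "s \<in> T \<Longrightarrow> s < Sup T \<Longrightarrow> s \<in> upper_kappa T"
  by (auto simp: upper_kappa_eq bwd_jump_ge)

lemma greater_Inf_lower_kappa: "t \<in> T \<Longrightarrow> Inf T < t \<Longrightarrow> t \<in> lower_kappa T"
  using fwd_jump_le[of t "Inf T"] by (auto simp: lower_kappa_def)

lemma bwd_jump_upper_kappa: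
  assumes "t \<in> upper_kappa T"
  shows "bwd_jump T t \<in> upper_kappa T"
  using assms bwd_jump_mem[of t] bwd_jump_le[of t] by (auto simp: upper_kappa_eq)

lemma left_dense_islimpt:
  assumes t: "t \<in> upper_kappa T" and dense: "bwd_jump T t = t" "Inf T < t"
  shows "t islimpt upper_kappa T"
  unfolding islimpt_approachable
proof (intro allI impI)
  fix e :: real assume "0 < e"
  have "t \<in> T" using t upper_kappa_subset by blast
  then obtain s where s: "s \<in> T" "t - e < s" "s < t"
    using left_dense_approx[OF _ dense, of "t - e"] \<open>0 < e\<close> by auto
  then have "s \<in> upper_kappa T" using le_Sup[OF \<open>t \<in> T\<close>] by (intro less_Sup_upper_kappa) auto
  then show "\<exists>s\<in>upper_kappa T. s \<noteq> t \<and> dist s t < e" using s by (auto simp: dist_real_def)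
qed

lemma right_dense_islimpt:
  assumes t: "t \<in> T" and dense: "fwd_jump T t = t" "t < Sup T"
  shows "t islimpt T"
  unfolding islimpt_approachable
proof (intro allI impI)
  fix e :: real assume "0 < e"
  then obtain s where s: "s \<in> T" "t < s" "s < t + e"
    using right_dense_approx[OF t dense, of "t + e"] by auto
  then show "\<exists>s\<in>T. s \<noteq> t \<and> dist s t < e" by (auto simp: dist_real_def)
qed

text \<open>
  This makes delta derivatives unique. At the maximum the jump is trivial by convention, and there
  it is membership in \<open>upper_kappa T\<close> that forces left-density.
\<close>
lemma fwd_jump_fixed_islimpt:
  assumes t: "t \<in> upper_kappa T" and "fwd_jump T t = t" "Inf T < Sup T"
  shows "t islimpt T"
proof (cases "t = Sup T")
  case True
  then have "bwd_jump T t = t"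
    using t bwd_jump_le[OF Sup_mem] by (auto simp: upper_kappa_eq)
  then show ?thesis
    using left_dense_islimpt[OF t] True assms islimpt_subset[OF _ upper_kappa_subset] by auto
next
  case False
  then show ?thesis using assms upper_kappa_subset le_Sup by (intro right_dense_islimpt) (auto simp: order_less_le)
qed

lemma has_delta_derivative_unique:
  assumes "has_delta_derivative T f d t" "has_delta_derivative T f d' t"
    and "t \<in> upper_kappa T" "Inf T < Sup T"
  shows "d = d'"
  using has_jump_derivative_unique[of T "fwd_jump T t" f d t d'] assms upper_kappa_subset
  by (auto simp: has_delta_derivative_iff_jump fwd_jump_fixed_islimpt)

lemma delta_deriv_eqI:
  assumes "has_delta_derivative T f d t" "t \<in> upper_kappa T" "Inf T < Sup T"
  shows "delta_deriv T f t = d"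
  unfolding delta_deriv_def
  using assms has_delta_derivative_unique by blast

lemma nabla_deriv_eqI:
  assumes "has_nabla_derivative T D f d t" "t \<in> upper_kappa T" "Inf T < t"
    and D: "upper_kappa T \<subseteq> D"
  shows "nabla_deriv T D f t = d"
proof -
  have "bwd_jump T t = t \<Longrightarrow> t islimpt D"
    using assms left_dense_islimpt islimpt_subset by blast
  then have "d' = d" if "has_nabla_derivative T D f d' t" for d'
    using has_jump_derivative_unique[of D "bwd_jump T t" f d' t d] assms that
    by (auto simp: has_nabla_derivative_iff_jump)
  then show ?thesis unfolding nabla_deriv_def using assms(1) by blast
qed

text \<open>
  A point of \<open>T\<close> outside \<open>upper_kappa T\<close> can only be a left-scattered maximum, which is isolated.
\<close>
lemma delta_differentiable_continuous_on:
  assumes "\<forall>t\<in>upper_kappa T. delta_differentiable T f t"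
  shows "continuous_on T f"
  unfolding continuous_on_eq_continuous_within
proof
  fix t assume t: "t \<in> T"
  show "continuous (at t within T) f"
  proof (cases "t \<in> upper_kappa T")
    case True
    then show ?thesis using assms t
      by (auto simp: delta_differentiable_def has_delta_derivative_iff_jump intro: has_jump_derivative_continuous)
  next
    case False
    then have "t = Sup T" using le_Sup[OF t] less_Sup_upper_kappa[OF t] by linarith
    with False t have "bwd_jump T t < t" by (auto simp: upper_kappa_eq)
    moreover have "s = t \<or> s \<le> bwd_jump T t" if "s \<in> T" for s
      using that \<open>t = Sup T\<close> le_Sup[OF that] bwd_jump_ge[OF that, of t] by (cases "s = t") auto
    ultimately have "\<not> t islimpt T"
      unfolding islimpt_approachable not_all
      by (intro exI[of _ "t - bwd_jump T t"]) (force simp: dist_real_def)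
    then have "at t within T = bot" by (simp add: trivial_limit_within)
    then show ?thesis by (simp add: continuous_bot)
  qed
qed

text \<open>
  Dually, a point outside \<open>lower_kappa T\<close> can only be a right-scattered minimum.
\<close>
lemma nabla_differentiable_continuous_on:
  assumes "\<forall>t\<in>D \<inter> lower_kappa T. nabla_differentiable T D f t" "D \<subseteq> T"
  shows "continuous_on D f"
  unfolding continuous_on_eq_continuous_within
proof
  fix t assume t: "t \<in> D"
  show "continuous (at t within D) f"
  proof (cases "t \<in> lower_kappa T")
    case True
    then show ?thesis using assms t
      by (auto simp: nabla_differentiable_def has_nabla_derivative_iff_jump intro: has_jump_derivative_continuous)
  next
    case False
    then have "t = Inf T" using t assms(2) Inf_le[of t] greater_Inf_lower_kappa[of t] by fastforce
    with False t assms(2) have "t < fwd_jump T t" by (auto simp: lower_kappa_def)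
    moreover have "s = t \<or> fwd_jump T t \<le> s" if "s \<in> D" for s
      using that \<open>t = Inf T\<close> assms(2) Inf_le[of s] fwd_jump_le[of s t] by (cases "s = t") auto
    ultimately have "\<not> t islimpt D"
      unfolding islimpt_approachable not_all
      by (intro exI[of _ "fwd_jump T t - t"]) (force simp: dist_real_def)
    then have "at t within D = bot" by (simp add: trivial_limit_within)
    then show ?thesis by (simp add: continuous_bot)
  qed
qed

text \<open>
  If \<open>s < t\<close> then \<open>\<sigma>(s) \<le> t\<close>; letting \<open>s\<close> tend to \<open>t\<close> from the left, continuity gives
  \<open>\<sigma>(t) \<le> t\<close>.
\<close>
lemma left_dense_fwd_jump_fixed:
  assumes cont: "continuous_on T (fwd_jump T)"
    and t: "t \<in> T" "bwd_jump T t = t" "Inf T < t"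
  shows "fwd_jump T t = t"
proof (rule antisym)
  show "fwd_jump T t \<le> t"
  proof (rule ccontr)
    assume "\<not> fwd_jump T t \<le> t"
    then obtain d where d: "d > 0"
      "\<And>s. s \<in> T \<Longrightarrow> dist s t < d \<Longrightarrow> dist (fwd_jump T s) (fwd_jump T t) < fwd_jump T t - t"
      using cont t(1) unfolding continuous_on_iff by (metis diff_gt_0_iff_gt not_le)
    obtain s where s: "s \<in> T" "t - d < s" "s < t"
      using left_dense_approx[OF t, of "t - d"] d by auto
    have "fwd_jump T s \<le> t" using fwd_jump_le[OF t(1) s(3)] .
    then show False using d(2)[OF s(1)] s by (auto simp: dist_real_def)
  qed
qed (use fwd_jump_ge t in auto)

section \<open>Functions with vanishing nabla derivative\<close>

text \<open>
  Tilt \<open>F\<close> to \<open>G s = F s - \<epsilon> (s - Inf T)\<close> and suppose that \<open>G c\<close> exceeds \<open>G (Inf T)\<close>.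
  At the first point \<open>m\<close> where \<open>G\<close> reaches \<open>G c\<close>, every value of \<open>G\<close> to the left of \<open>m\<close> is smaller
  than \<open>G m\<close>. The nabla derivative of \<open>G\<close> at \<open>m\<close> is \<open>-\<epsilon>\<close>, however, so some value to the left is
  at least as large: the one at \<open>\<rho>(m)\<close>, or those close to \<open>m\<close> if \<open>m\<close> is left-dense.
\<close>
lemma nabla_zero_imp_le_Inf:
  fixes F :: "real \<Rightarrow> real"
  assumes cont: "continuous_on (upper_kappa T) F"
    and deriv: "\<And>t. t \<in> upper_kappa T \<Longrightarrow> Inf T < t \<Longrightarrow> has_nabla_derivative T (upper_kappa T) F 0 t"
    and c: "c \<in> upper_kappa T"
  shows "F c \<le> F (Inf T)"
proof -
  let ?K = "upper_kappa T" and ?a = "Inf T"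
  have le: "F c - \<epsilon> * (c - ?a) \<le> F ?a" if "\<epsilon> > 0" for \<epsilon>
  proof (rule ccontr)
    assume less: "\<not> ?thesis"
    define G where "G s = F s - \<epsilon> * (s - ?a)" for s
    define S where "S = ?K \<inter> G -` {G c..}"
    define m where "m = Inf S"
    have "continuous_on ?K G"
      unfolding G_def using cont by (intro continuous_intros)
    then have "closed S" unfolding S_def
      by (intro continuous_closed_preimage compact_imp_closed compact_upper_kappa closed_atLeast)
    moreover have "c \<in> S" using c by (simp add: S_def)
    moreover have "bdd_below S"
      using compact_upper_kappa by (auto simp: S_def intro!: bounded_imp_bdd_below bounded_subset[OF compact_imp_bounded])
    ultimately have "m \<in> S" and m_le: "\<And>s. s \<in> S \<Longrightarrow> m \<le> s"
      unfolding m_def by (auto intro: closed_contains_Inf cInf_lower)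
    then have m: "m \<in> ?K" "G c \<le> G m" by (auto simp: S_def)
    have below: "G s < G m" if "s \<in> ?K" "s < m" for s
      using m_le[of s] that m by (force simp: S_def)
    have "m \<in> T" using m upper_kappa_subset by blast
    have "m \<noteq> ?a" using m less by (auto simp: G_def)
    with Inf_le[OF \<open>m \<in> T\<close>] have "?a < m" by simp
    note dm = deriv[OF m(1) this, unfolded has_nabla_derivative_iff_jump]
    show False
    proof (cases "bwd_jump T m = m")
      case True
      then have "(F has_derivative (\<lambda>h. 0)) (at m within ?K)"
        using dm by (simp add: has_jump_derivative_dense has_vector_derivative_def)
      then obtain d where d: "d > 0"
        "\<And>s. s \<in> ?K \<Longrightarrow> norm (s - m) < d \<Longrightarrow> norm (F s - F m - 0) \<le> \<epsilon> * norm (s - m)"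
        using \<open>\<epsilon> > 0\<close> unfolding has_derivative_within_alt by blast
      obtain s where s: "s \<in> T" "m - d < s" "s < m"
        using left_dense_approx[OF \<open>m \<in> T\<close> True \<open>?a < m\<close>, of "m - d"] d by auto
      have "s \<in> ?K" using s le_Sup[OF \<open>m \<in> T\<close>] by (intro less_Sup_upper_kappa) auto
      then have "\<bar>F s - F m\<bar> \<le> \<epsilon> * (m - s)" using d(2)[of s] s by auto
      moreover have "F s - \<epsilon> * (s - ?a) < F m - \<epsilon> * (m - ?a)"
        using below[OF \<open>s \<in> ?K\<close> s(3)] by (simp add: G_def)
      ultimately show False by (simp add: algebra_simps)
    next
      case False
      with bwd_jump_le[OF \<open>m \<in> T\<close>] have less: "bwd_jump T m < m" by simp
      have "F m = F (bwd_jump T m)" using has_jump_derivative_diff[OF dm m(1)] by simp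
      moreover have "F (bwd_jump T m) - \<epsilon> * (bwd_jump T m - ?a) < F m - \<epsilon> * (m - ?a)"
        using below[OF bwd_jump_upper_kappa[OF m(1)] less] by (simp add: G_def)
      ultimately show False using less \<open>\<epsilon> > 0\<close> by simp
    qed
  qed
  have ca: "?a \<le> c" using c upper_kappa_subset Inf_le by blast
  show ?thesis
  proof (rule field_le_epsilon)
    fix e :: real assume "0 < e"
    have "F c \<le> F ?a + e / (c - ?a + 1) * (c - ?a)"
      using le[of "e / (c - ?a + 1)"] \<open>0 < e\<close> ca by simp
    also have "e / (c - ?a + 1) * (c - ?a) \<le> e"
      using \<open>0 < e\<close> ca by (simp add: pos_divide_le_eq)
    finally show "F c \<le> F ?a + e" by simp
  qed
qed

lemma nabla_zero_imp_constant:
  fixes F :: "real \<Rightarrow> real"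
  assumes cont: "continuous_on (upper_kappa T) F"
    and deriv: "\<And>t. t \<in> upper_kappa T \<Longrightarrow> Inf T < t \<Longrightarrow> has_nabla_derivative T (upper_kappa T) F 0 t"
    and c: "c \<in> upper_kappa T"
  shows "F c = F (Inf T)"
proof (rule antisym)
  show "F c \<le> F (Inf T)" by (rule nabla_zero_imp_le_Inf[OF cont deriv c])
  have "- F c \<le> - F (Inf T)"
  proof (rule nabla_zero_imp_le_Inf[OF _ _ c])
    show "continuous_on (upper_kappa T) (\<lambda>s. - F s)" using cont by (intro continuous_intros)
    fix t assume "t \<in> upper_kappa T" "Inf T < t"
    from tendsto_minus[OF deriv[OF this, unfolded has_nabla_derivative_def]]
    show "has_nabla_derivative T (upper_kappa T) (\<lambda>s. - F s) 0 t"
      unfolding has_nabla_derivative_def by (simp add: algebra_simps)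
  qed
  then show "F (Inf T) \<le> F c" by simp
qed

end

section \<open>Gradients of the Lagrangian\<close>

lemma gradient_inner:
  fixes f :: "'a::euclidean_space \<Rightarrow> real"
  assumes "(f has_derivative f') (at x)"
  shows "f' h = gradient f x \<bullet> h"
proof -
  have "linear f'" using assms by (rule has_derivative_linear)
  then have f': "f' = (\<lambda>h. h \<bullet> adjoint f' 1)"
    using adjoint_works[of f' _ 1] by (auto simp: fun_eq_iff)
  have "D = adjoint f' 1" if "GDERIV f x :> D" for D
  proof -
    have "f' = (\<lambda>h. h \<bullet> D)"
      using assms that unfolding gderiv_def by (rule has_derivative_unique)
    then have "h \<bullet> D = h \<bullet> adjoint f' 1" for h
      using f' by metis
    then show ?thesis by (metis vector_eq_rdot inner_commute)
  qed
  moreover have "GDERIV f x :> adjoint f' 1"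
    unfolding gderiv_def using assms f' by simp
  ultimately have "gradient f x = adjoint f' 1"
    unfolding gradient_def by blast
  then show ?thesis using f' by (metis inner_commute)
qed

text \<open>
  The two partial gradients of the Lagrangian are the restrictions of its joint derivative to the
  coordinate subspaces, which turns the chain rule for \<open>L\<close> into a sum of two inner products.
\<close>
lemma lagrangian_has_derivative:
  fixes L :: "real ^ 'n \<Rightarrow> real ^ 'n \<Rightarrow> real \<Rightarrow> real"
  assumes "lagrangian T L" "t \<in> upper_kappa T"
  shows "((\<lambda>(x, v). L x v t) has_derivative (\<lambda>(h, k). dL_dx L x v t \<bullet> h + dL_dv L x v t \<bullet> k)) (at (x, v))"
proof -
  have "C1_on (\<lambda>(x, v). L x v t) UNIV" using assms by (simp add: lagrangian_def)
  then obtain L' where "\<forall>z\<in>UNIV. ((\<lambda>(x, v). L x v t) has_derivative blinfun_apply (L' z)) (at z)"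
    unfolding C1_on_def by blast
  then have L': "((\<lambda>(x, v). L x v t) has_derivative blinfun_apply (L' (x, v))) (at (x, v))" for x v
    by blast
  have pairs: "((\<lambda>y. (y, v)) has_derivative (\<lambda>h. (h, 0))) (at x)"
      "((\<lambda>w. (x, w)) has_derivative (\<lambda>k. (0, k))) (at v)"
    by (auto intro!: derivative_eq_intros)
  have "((\<lambda>y. L y v t) has_derivative (\<lambda>h. L' (x, v) (h, 0))) (at x)"
    using has_derivative_compose[OF pairs(1) L'[of x v]] by simp
  then have "L' (x, v) (h, 0) = dL_dx L x v t \<bullet> h" for h
    unfolding dL_dx_def by (rule gradient_inner)
  moreover have "((\<lambda>w. L x w t) has_derivative (\<lambda>k. L' (x, v) (0, k))) (at v)"
    using has_derivative_compose[OF pairs(2) L'[of x v]] by simp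
  then have "L' (x, v) (0, k) = dL_dv L x v t \<bullet> k" for k
    unfolding dL_dv_def by (rule gradient_inner)
  moreover have "L' (x, v) z = L' (x, v) (fst z, 0) + L' (x, v) (0, snd z)" for z
    by (simp flip: blinfun.add_right)
  ultimately have "L' (x, v) z = dL_dx L x v t \<bullet> fst z + dL_dv L x v t \<bullet> snd z" for z
    by metis
  then have "blinfun_apply (L' (x, v)) = (\<lambda>(h, k). dL_dx L x v t \<bullet> h + dL_dv L x v t \<bullet> k)"
    by (simp only: fun_eq_iff split_beta) simp
  then show ?thesis using L'[of x v] by simp
qed

section \<open>The generator of a family of transformations\<close>

text \<open>
  The derivatives within the strip \<open>[-\<eta>, \<eta>] \<times> \<real>\<^sup>n\<close> are full derivatives at interior points, and
  near \<open>\<theta> = 0\<close> no others matter.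
\<close>
lemma transformations_derivatives:
  fixes \<Phi> :: "real \<times> (real ^ 'n) \<Rightarrow> real ^ 'n"
  assumes "infinitesimal_transformations \<eta> \<Phi>"
  obtains \<Phi>' \<Phi>'' where
    "\<And>\<theta> x. \<theta> \<in> {-\<eta><..<\<eta>} \<Longrightarrow> (\<Phi> has_derivative blinfun_apply (\<Phi>' (\<theta>, x))) (at (\<theta>, x))"
    "\<And>x. (\<Phi>' has_derivative blinfun_apply (\<Phi>'' x)) (at (0, x))"
proof -
  let ?S = "{-\<eta>..\<eta>} \<times> (UNIV :: (real ^ 'n) set)" and ?U = "{-\<eta><..<\<eta>} \<times> (UNIV :: (real ^ 'n) set)"
  have \<eta>: "\<eta> > 0" and C2: "C2_on \<Phi> ?S"
    using assms by (auto simp: infinitesimal_transformations_def)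
  have at: "at z within ?S = at z" if "z \<in> ?U" for z
    using that by (intro at_within_open_subset[of _ ?U]) (auto intro: open_Times)
  obtain \<Phi>' where d1: "\<And>z. z \<in> ?S \<Longrightarrow> (\<Phi> has_derivative blinfun_apply (\<Phi>' z)) (at z within ?S)"
    and "C1_on \<Phi>' ?S"
    using C2 unfolding C2_on_def by blast
  then obtain \<Phi>'' where d2: "\<And>z. z \<in> ?S \<Longrightarrow> (\<Phi>' has_derivative blinfun_apply (\<Phi>'' z)) (at z within ?S)"
    unfolding C1_on_def by blast
  show thesis
  proof (rule that[of \<Phi>' "\<lambda>x. \<Phi>'' (0, x)"])
    fix \<theta> x assume "\<theta> \<in> {-\<eta><..<\<eta>}"
    then show "(\<Phi> has_derivative blinfun_apply (\<Phi>' (\<theta>, x))) (at (\<theta>, x))"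
      using d1[of "(\<theta>, x)"] at[of "(\<theta>, x)"] by auto
  next
    fix x show "(\<Phi>' has_derivative blinfun_apply (\<Phi>'' (0, x))) (at (0, x))"
      using d2[of "(0, x)"] at[of "(0, x)"] \<eta> by auto
  qed
qed

text \<open>
  All that is used of \<open>\<Phi>\<close> later on. The content is that one and the same \<open>Q\<close> is the space
  derivative of the generator and the \<open>\<theta>\<close>-derivative at \<open>0\<close> of the space derivative \<open>P\<close>; this is
  the equality of the mixed second derivatives of \<open>\<Phi>\<close>.
\<close>
lemma dPhi_dtheta0_derivatives:
  fixes \<Phi> :: "real \<times> (real ^ 'n) \<Rightarrow> real ^ 'n"
  assumes "infinitesimal_transformations \<eta> \<Phi>"
  obtains P Q where
    "\<And>\<theta> x. \<theta> \<in> {-\<eta><..<\<eta>} \<Longrightarrow> ((\<lambda>y. \<Phi> (\<theta>, y)) has_derivative P \<theta> x) (at x)"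
    "\<And>x. ((\<lambda>\<theta>. \<Phi> (\<theta>, x)) has_vector_derivative dPhi_dtheta0 \<Phi> x) (at 0)"
    "\<And>x. (dPhi_dtheta0 \<Phi> has_derivative Q x) (at x)"
    "\<And>x h. ((\<lambda>\<theta>. P \<theta> x h) has_vector_derivative Q x h) (at 0)"
proof -
  obtain \<Phi>' :: "real \<times> (real ^ 'n) \<Rightarrow> _" and \<Phi>'' where
    d1: "\<And>\<theta> x. \<theta> \<in> {-\<eta><..<\<eta>} \<Longrightarrow> (\<Phi> has_derivative blinfun_apply (\<Phi>' (\<theta>, x))) (at (\<theta>, x))" and
    d2: "\<And>x. (\<Phi>' has_derivative blinfun_apply (\<Phi>'' x)) (at (0, x))"
    using transformations_derivatives[OF assms] by metis
  have \<eta>: "\<eta> > 0" using assms by (auto simp: infinitesimal_transformations_def)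
  have sym: "\<Phi>'' x h k = \<Phi>'' x k h" for x h k
  proof (rule second_derivative_symmetric[OF _ d2])
    have "open ({-\<eta><..<\<eta>} \<times> (UNIV :: (real ^ 'n) set))" by (intro open_Times) auto
    then have "\<forall>\<^sub>F z in nhds (0, x). z \<in> {-\<eta><..<\<eta>} \<times> (UNIV :: (real ^ 'n) set)"
      using \<eta> by (intro eventually_nhds_in_open) auto
    then show "\<forall>\<^sub>F z in nhds (0, x). (\<Phi> has_derivative blinfun_apply (\<Phi>' z)) (at z)"
      by eventually_elim (use d1 in auto)
  qed
  have \<theta>: "((\<lambda>\<theta>. (\<theta>, x)) has_derivative (\<lambda>h. (h, 0))) (at \<theta>)" for \<theta> :: real and x :: "real ^ 'n"
    by (auto intro!: derivative_eq_intros)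
  have x: "((\<lambda>x. (\<theta>, x)) has_derivative (\<lambda>h. (0, h))) (at x)" for \<theta> :: real and x :: "real ^ 'n"
    by (auto intro!: derivative_eq_intros)
  have w: "((\<lambda>\<theta>. \<Phi> (\<theta>, x)) has_vector_derivative \<Phi>' (0, x) (1, 0)) (at 0)" for x
  proof -
    have "((\<lambda>\<theta>. \<Phi> (\<theta>, x)) has_derivative (\<lambda>h. \<Phi>' (0, x) (h, 0))) (at 0)"
      using \<theta> d1[of 0 x] \<eta> by (intro has_derivative_compose[where f = "\<lambda>\<theta>. (\<theta>, x)" and g = \<Phi>]) auto
    moreover have "(\<lambda>h. \<Phi>' (0, x) (h, 0)) = (\<lambda>h. h *\<^sub>R \<Phi>' (0, x) (1, 0))"
      by (simp flip: blinfun.scaleR_right)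
    ultimately show ?thesis unfolding has_vector_derivative_def by (simp only:)
  qed
  then have w_eq: "dPhi_dtheta0 \<Phi> = (\<lambda>x. \<Phi>' (0, x) (1, 0))"
    unfolding dPhi_dtheta0_def by (intro ext vector_derivative_at)
  have ev: "bounded_linear (\<lambda>A :: (real \<times> (real ^ 'n)) \<Rightarrow>\<^sub>L (real ^ 'n). A z)" for z
    by (rule blinfun.bounded_linear_left)
  show thesis
  proof (rule that[of "\<lambda>\<theta> x h. \<Phi>' (\<theta>, x) (0, h)" "\<lambda>x h. \<Phi>'' x (0, h) (1, 0)"])
    fix \<theta> x assume "\<theta> \<in> {-\<eta><..<\<eta>}"
    from has_derivative_compose[OF x d1[OF this]]
    show "((\<lambda>y. \<Phi> (\<theta>, y)) has_derivative (\<lambda>h. \<Phi>' (\<theta>, x) (0, h))) (at x)" by simp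
  next
    fix x show "((\<lambda>\<theta>. \<Phi> (\<theta>, x)) has_vector_derivative dPhi_dtheta0 \<Phi> x) (at 0)"
      using w w_eq by simp
  next
    fix x
    have "((\<lambda>x. \<Phi>' (0, x)) has_derivative (\<lambda>h. \<Phi>'' x (0, h))) (at x)"
      by (rule has_derivative_compose[OF x d2])
    from bounded_linear.has_derivative[OF ev this]
    show "(dPhi_dtheta0 \<Phi> has_derivative (\<lambda>h. \<Phi>'' x (0, h) (1, 0))) (at x)"
      by (simp add: w_eq)
  next
    fix x h
    have "((\<lambda>\<theta>. \<Phi>' (\<theta>, x)) has_derivative (\<lambda>k. \<Phi>'' x (k, 0))) (at 0)"
      by (rule has_derivative_compose[OF \<theta> d2])
    from bounded_linear.has_derivative[OF ev this, of "(0, h)"]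
    have "((\<lambda>\<theta>. \<Phi>' (\<theta>, x) (0, h)) has_derivative (\<lambda>k. \<Phi>'' x (k, 0) (0, h))) (at 0)" .
    moreover have "\<Phi>'' x (k, 0) (0, h) = k *\<^sub>R \<Phi>'' x (0, h) (1, 0)" for k
    proof -
      have "\<Phi>'' x (k, 0) (0, h) = \<Phi>'' x (k *\<^sub>R (1, 0)) (0, h)" by simp
      also have "\<dots> = k *\<^sub>R \<Phi>'' x (1, 0) (0, h)"
        by (simp only: blinfun.scaleR_right blinfun.scaleR_left)
      finally show ?thesis by (simp only: sym[of x "(1, 0)"])
    qed
    ultimately show "((\<lambda>\<theta>. \<Phi>' (\<theta>, x) (0, h)) has_vector_derivative
        \<Phi>'' x (0, h) (1, 0)) (at 0)"
      unfolding has_vector_derivative_def by simp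
  qed
qed

section \<open>Invariance and the conserved quantity\<close>

context bounded_time_scale
begin

text \<open>
  Differentiation in \<open>\<theta>\<close> commutes with the delta derivative. Where \<open>\<sigma>(t) = t\<close>, the delta derivative
  of \<open>\<Phi>(\<theta>, u)\<close> is the space derivative of \<open>\<Phi>\<close> applied to \<open>u\<^sup>\<Delta>(t)\<close>, and mixed derivatives agree;
  elsewhere it is a difference quotient of two fixed curves in \<open>\<theta>\<close>.
\<close>
lemma delta_deriv_transformation:
  fixes \<Phi> :: "real \<times> (real ^ 'n) \<Rightarrow> real ^ 'n"
  assumes \<Phi>: "infinitesimal_transformations \<eta> \<Phi>"
    and t: "t \<in> upper_kappa T" and T: "Inf T < Sup T"
    and u: "has_delta_derivative T u v t"
  obtains W where "has_delta_derivative T (\<lambda>s. dPhi_dtheta0 \<Phi> (u s)) W t"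
    and "((\<lambda>\<theta>. delta_deriv T (\<lambda>s. \<Phi> (\<theta>, u s)) t) has_vector_derivative W) (at 0)"
proof -
  let ?w = "dPhi_dtheta0 \<Phi>" and ?V = "\<lambda>\<theta>. delta_deriv T (\<lambda>s. \<Phi> (\<theta>, u s)) t" and ?I = "{-\<eta><..<\<eta>}"
  obtain P Q where
    P: "\<And>\<theta> x. \<theta> \<in> {-\<eta><..<\<eta>} \<Longrightarrow> ((\<lambda>y. \<Phi> (\<theta>, y)) has_derivative P \<theta> x) (at x)" and
    w: "\<And>x. ((\<lambda>\<theta>. \<Phi> (\<theta>, x)) has_vector_derivative ?w x) (at 0)" and
    Q: "\<And>x. (?w has_derivative Q x) (at x)" and
    PQ: "\<And>x h. ((\<lambda>\<theta>. P \<theta> x h) has_vector_derivative Q x h) (at 0)"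
    using dPhi_dtheta0_derivatives[OF \<Phi>] by metis
  have \<eta>: "0 \<in> ?I" using \<Phi> by (auto simp: infinitesimal_transformations_def)
  have tT: "t \<in> T" using t upper_kappa_subset by blast
  \<comment> \<open>Delta derivatives are known only for small \<open>\<theta>\<close>, which suffices at \<open>\<theta> = 0\<close>.\<close>
  have transfer: "(?V has_vector_derivative W) (at 0)"
    if "(V has_vector_derivative W) (at 0)"
      and V: "\<And>\<theta>. \<theta> \<in> ?I \<Longrightarrow> has_delta_derivative T (\<lambda>s. \<Phi> (\<theta>, u s)) (V \<theta>) t" for V W
  proof (rule has_vector_derivative_transform_within_open[OF that(1) _ \<eta>])
    show "V \<theta> = ?V \<theta>" if "\<theta> \<in> ?I" for \<theta>
      using delta_deriv_eqI[OF _ t T] V[OF that]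
      by metis
  qed simp
  show thesis
  proof (cases "fwd_jump T t = t")
    case True
    have u': "(u has_vector_derivative v) (at t within T)"
      using u True by (simp add: has_delta_derivative_iff_jump has_jump_derivative_dense)
    have chain: "has_delta_derivative T (\<lambda>s. g (u s)) (g' v) t" if "(g has_derivative g') (at (u t))"
      for g :: "real ^ 'n \<Rightarrow> real ^ 'n" and g'
    proof -
      have "((\<lambda>s. g (u s)) has_derivative (\<lambda>h. g' (h *\<^sub>R v))) (at t within T)"
        using u'[unfolded has_vector_derivative_def] that by (rule has_derivative_compose)
      moreover have "g' (h *\<^sub>R v) = h *\<^sub>R g' v" for h
        using has_derivative_linear[OF that] by (rule linear_scale)
      ultimately show ?thesis
        by (simp add: has_delta_derivative_iff_jump True has_jump_derivative_dense has_vector_derivative_def)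
    qed
    show ?thesis
    proof (rule that)
      show "has_delta_derivative T (\<lambda>s. ?w (u s)) (Q (u t) v) t" by (rule chain[OF Q])
      show "(?V has_vector_derivative Q (u t) v) (at 0)"
        by (rule transfer[OF PQ]) (rule chain[OF P])
    qed
  next
    case False
    let ?j = "fwd_jump T t"
    have "continuous (at t within T) u"
      using u tT has_jump_derivative_continuous has_delta_derivative_iff_jump by blast
    then have quot: "has_delta_derivative T (\<lambda>s. g (u s)) ((g (u t) - g (u ?j)) /\<^sub>R (t - ?j)) t"
      if "(g has_derivative g') (at (u t))" for g :: "real ^ 'n \<Rightarrow> real ^ 'n" and g'
    proof -
      have "continuous (at t within T) (\<lambda>s. g (u s))"
        using has_derivative_continuous[OF that] \<open>continuous (at t within T) u\<close>
        by (rule continuous_within_compose3)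
      then show ?thesis
        using False tT by (simp add: has_delta_derivative_iff_jump has_jump_derivative_scattered)
    qed
    show ?thesis
    proof (rule that)
      show "has_delta_derivative T (\<lambda>s. ?w (u s)) ((?w (u t) - ?w (u ?j)) /\<^sub>R (t - ?j)) t"
        by (rule quot[OF Q])
      have "((\<lambda>\<theta>. (\<Phi> (\<theta>, u t) - \<Phi> (\<theta>, u ?j)) /\<^sub>R (t - ?j)) has_vector_derivative
          (?w (u t) - ?w (u ?j)) /\<^sub>R (t - ?j)) (at 0)"
        by (intro bounded_linear.has_vector_derivative[OF bounded_linear_scaleR_right]
            has_vector_derivative_diff w)
      then show "(?V has_vector_derivative (?w (u t) - ?w (u ?j)) /\<^sub>R (t - ?j)) (at 0)"
        by (rule transfer) (rule quot[OF P])
    qed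
  qed
qed

text \<open>
  The curve \<open>\<theta> \<mapsto> (\<Phi>(\<theta>, u(t)), \<Phi>(\<theta>, u)\<^sup>\<Delta>(t))\<close> passes through \<open>(u(t), u\<^sup>\<Delta>(t))\<close> with velocity
  \<open>(w(u(t)), (w \<circ> u)\<^sup>\<Delta>(t))\<close>; the identity is the chain rule for \<open>L\<close> along it.
\<close>
lemma infinitesimal_invariance:
  fixes \<Phi> :: "real \<times> (real ^ 'n) \<Rightarrow> real ^ 'n"
  assumes \<Phi>: "infinitesimal_transformations \<eta> \<Phi>"
    and L: "lagrangian T L"
    and t: "t \<in> upper_kappa T" and T: "Inf T < Sup T"
    and u: "delta_differentiable T u t"
    and inv: "((\<lambda>\<theta>. L (\<Phi> (\<theta>, u t)) (delta_deriv T (\<lambda>s. \<Phi> (\<theta>, u s)) t) t)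
      has_real_derivative 0) (at 0)"
  obtains W where "has_delta_derivative T (\<lambda>s. dPhi_dtheta0 \<Phi> (u s)) W t"
    and "dL_dx L (u t) (delta_deriv T u t) t \<bullet> dPhi_dtheta0 \<Phi> (u t) +
      dL_dv L (u t) (delta_deriv T u t) t \<bullet> W = 0"
proof -
  let ?w = "dPhi_dtheta0 \<Phi>" and ?V = "\<lambda>\<theta>. delta_deriv T (\<lambda>s. \<Phi> (\<theta>, u s)) t"
    and ?p = "dL_dv L (u t) (delta_deriv T u t) t" and ?q = "dL_dx L (u t) (delta_deriv T u t) t"
  obtain v where v: "has_delta_derivative T u v t" using u by (auto simp: delta_differentiable_def)
  obtain W where W: "has_delta_derivative T (\<lambda>s. ?w (u s)) W t" "(?V has_vector_derivative W) (at 0)"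
    using delta_deriv_transformation[OF \<Phi> t T v] by blast
  have \<Phi>0: "\<Phi> (0, x) = x" for x using \<Phi> by (simp add: infinitesimal_transformations_def)
  have "((\<lambda>\<theta>. \<Phi> (\<theta>, u t)) has_vector_derivative ?w (u t)) (at 0)"
    using dPhi_dtheta0_derivatives[OF \<Phi>] by metis
  from has_derivative_Pair[OF this[unfolded has_vector_derivative_def] W(2)[unfolded has_vector_derivative_def]]
  have curve: "((\<lambda>\<theta>. (\<Phi> (\<theta>, u t), ?V \<theta>)) has_derivative (\<lambda>h. (h *\<^sub>R ?w (u t), h *\<^sub>R W))) (at 0)" .
  have "((\<lambda>\<theta>. L (\<Phi> (\<theta>, u t)) (?V \<theta>) t) has_derivative
      (\<lambda>h. ?q \<bullet> (h *\<^sub>R ?w (u t)) + ?p \<bullet> (h *\<^sub>R W))) (at 0)"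
    using has_derivative_compose[OF curve, of "\<lambda>(x, v). L x v t" "\<lambda>(h, k). ?q \<bullet> h + ?p \<bullet> k"]
      lagrangian_has_derivative[OF L t, of "u t" "delta_deriv T u t"] by (simp add: \<Phi>0)
  then have "((\<lambda>\<theta>. L (\<Phi> (\<theta>, u t)) (?V \<theta>) t) has_real_derivative ?q \<bullet> ?w (u t) + ?p \<bullet> W) (at 0)"
    unfolding has_field_derivative_def
    by (rule has_derivative_eq_rhs) (auto simp: fun_eq_iff distrib_left distrib_right mult.commute)
  then have "?q \<bullet> ?w (u t) + ?p \<bullet> W = 0" using inv by (rule DERIV_unique)
  with W(1) show thesis by (rule that)
qed

text \<open>
  Here \<open>g\<close> stands for \<open>w \<circ> u\<close>, and the hypothesis on \<open>p\<close> is the Euler-Lagrange equation. At a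
  left-dense point the derivative of \<open>p \<bullet> (g \<circ> \<sigma>)\<close> is \<open>\<sigma>\<^sup>\<nabla> (q \<bullet> g + p \<bullet> W)\<close> by the product and chain
  rules. At a left-scattered point the increment of \<open>p \<bullet> (g \<circ> \<sigma>)\<close> from \<open>\<rho>(t)\<close> to \<open>t\<close> is
  \<open>(\<sigma>(t) - t) (q \<bullet> g(t) + p(t) \<bullet> W)\<close>, whether or not \<open>t\<close> is right-scattered.
\<close>
lemma conserved_quantity_nabla_zero:
  assumes p: "has_nabla_derivative T (upper_kappa T) p (s' *\<^sub>R q) t"
    and \<sigma>: "has_nabla_derivative T T (fwd_jump T) s' t"
    and g: "has_delta_derivative T g W t"
    and inv: "q \<bullet> g t + p t \<bullet> W = 0"
    and t: "t \<in> upper_kappa T" "Inf T < t"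
    and cont: "continuous_on T (fwd_jump T)" "continuous (at t within upper_kappa T) (\<lambda>s. p s \<bullet> g (fwd_jump T s))"
  shows "has_nabla_derivative T (upper_kappa T) (\<lambda>s. p s \<bullet> g (fwd_jump T s)) 0 t"
proof -
  let ?K = "upper_kappa T" and ?\<sigma> = "fwd_jump T" and ?r = "bwd_jump T t"
  have tT: "t \<in> T" using t upper_kappa_subset by blast
  note jump = has_nabla_derivative_iff_jump has_delta_derivative_iff_jump
  show ?thesis
  proof (cases "?r = t")
    case True
    have \<sigma>t: "?\<sigma> t = t" using left_dense_fwd_jump_fixed[OF cont(1) tT True t(2)] .
    have p': "(p has_vector_derivative s' *\<^sub>R q) (at t within ?K)"
      using p by (simp add: jump True has_jump_derivative_dense)
    have \<sigma>': "(?\<sigma> has_vector_derivative s') (at t within ?K)"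
      using \<sigma> has_vector_derivative_within_subset[OF _ upper_kappa_subset]
      by (simp add: jump True has_jump_derivative_dense)
    have "(g has_vector_derivative W) (at (?\<sigma> t) within ?\<sigma> ` ?K)"
      using g has_vector_derivative_within_subset[of g W t T "?\<sigma> ` ?K"] fwd_jump_mem
      by (auto simp: jump \<sigma>t has_jump_derivative_dense)
    from vector_diff_chain_within[OF \<sigma>' this]
    have "((\<lambda>s. g (?\<sigma> s)) has_vector_derivative s' *\<^sub>R W) (at t within ?K)"
      by (simp add: o_def)
    from bounded_bilinear.has_vector_derivative[OF bounded_bilinear_inner p' this]
    have "((\<lambda>s. p s \<bullet> g (?\<sigma> s)) has_vector_derivative p t \<bullet> (s' *\<^sub>R W) + (s' *\<^sub>R q) \<bullet> g t) (at t within ?K)"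
      by (simp add: \<sigma>t)
    moreover have "p t \<bullet> (s' *\<^sub>R W) + (s' *\<^sub>R q) \<bullet> g t = s' * (q \<bullet> g t + p t \<bullet> W)"
      by (simp add: algebra_simps)
    ultimately show ?thesis
      using inv by (simp add: jump True has_jump_derivative_dense)
  next
    case False
    with bwd_jump_le[OF tT] have \<sigma>r: "?\<sigma> ?r = t" by (intro fwd_jump_bwd_jump tT) simp
    have dp: "p t - p ?r = (t - ?r) *\<^sub>R s' *\<^sub>R q"
      using p t has_jump_derivative_diff unfolding jump by blast
    have d\<sigma>: "?\<sigma> t - t = (t - ?r) * s'"
      using has_jump_derivative_diff[OF \<sigma>[unfolded jump] tT] by (simp add: \<sigma>r)
    have dg: "g t - g (?\<sigma> t) = (t - ?\<sigma> t) *\<^sub>R W"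
      using g tT has_jump_derivative_diff unfolding jump by blast
    \<comment> \<open>Summation by parts; the value of \<open>g \<circ> \<sigma>\<close> at \<open>\<rho>(t)\<close> is \<open>g(t)\<close>.\<close>
    have "p t \<bullet> g (?\<sigma> t) - p ?r \<bullet> g t = (p t - p ?r) \<bullet> g t - p t \<bullet> (g t - g (?\<sigma> t))"
      by (simp add: inner_diff_left inner_diff_right)
    also have "\<dots> = ((t - ?r) * s') * (q \<bullet> g t) - (t - ?\<sigma> t) * (p t \<bullet> W)"
      by (simp add: dp dg)
    also have "\<dots> = (?\<sigma> t - t) * (q \<bullet> g t + p t \<bullet> W)"
      unfolding d\<sigma>[symmetric] by (simp add: algebra_simps)
    finally have "p t \<bullet> g (?\<sigma> t) - p ?r \<bullet> g t = 0" using inv by simp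
    then show ?thesis
      using cont(2) False t by (simp add: jump has_jump_derivative_scattered \<sigma>r)
  qed
qed

end

theorem theorem2:
  fixes T :: "real set"
    and L :: "real ^ 'n \<Rightarrow> real ^ 'n \<Rightarrow> real \<Rightarrow> real"
    and \<Phi> :: "real \<times> (real ^ 'n) \<Rightarrow> real ^ 'n"
    and \<eta> :: real
  assumes "time_scale T" and "bounded T" and "infinite T \<or> card T \<ge> 3"
    and "lagrangian T L"
    and "\<forall>t \<in> lower_kappa T. nabla_differentiable T T (fwd_jump T) t"
    and "infinitesimal_transformations \<eta> \<Phi>"
    and "invariant_under T L \<Phi>"
  shows "\<forall>u. EL_solution T L u \<longrightarrow>
           (\<exists>c :: real. \<forall>t \<in> upper_kappa T.
              dL_dv L (u t) (delta_deriv T u t) t \<bullet> dPhi_dtheta0 \<Phi> (u (fwd_jump T t)) = c)"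
proof (intro allI impI)
  fix u assume u: "EL_solution T L u"
  interpret bounded_time_scale T using assms(1,2) by unfold_locales
  let ?K = "upper_kappa T" and ?\<sigma> = "fwd_jump T" and ?w = "dPhi_dtheta0 \<Phi>"
  define p where "p t = dL_dv L (u t) (delta_deriv T u t) t" for t
  define q where "q t = dL_dx L (u t) (delta_deriv T u t) t" for t
  have u_diff: "\<forall>t\<in>?K. delta_differentiable T u t"
    using u by (simp add: EL_solution_def C1_delta_rd_def)
  have EL: "nabla_differentiable T ?K p t" "nabla_deriv T ?K p t = nabla_deriv T T ?\<sigma> t *\<^sub>R q t"
    if "t \<in> ?K \<inter> lower_kappa T" for t
    using u that unfolding EL_solution_def p_def q_def by auto
  have \<sigma>_cont: "continuous_on T ?\<sigma>"
    using assms(5) by (intro nabla_differentiable_continuous_on) auto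
  have "continuous_on ?K p"
    using EL(1) upper_kappa_subset by (intro nabla_differentiable_continuous_on) auto
  moreover have "continuous_on UNIV ?w"
    using dPhi_dtheta0_derivatives[OF assms(6)] by (metis has_derivative_continuous continuous_at_imp_continuous_on)
  moreover have "continuous_on ?K (\<lambda>s. u (?\<sigma> s))"
    using delta_differentiable_continuous_on[OF u_diff]
      continuous_on_subset[OF \<sigma>_cont upper_kappa_subset] fwd_jump_mem
    by (auto intro: continuous_on_compose2)
  ultimately have cont: "continuous_on ?K (\<lambda>s. p s \<bullet> ?w (u (?\<sigma> s)))"
    by (auto intro!: continuous_intros intro: continuous_on_compose2)
  have "has_nabla_derivative T ?K (\<lambda>s. p s \<bullet> ?w (u (?\<sigma> s))) 0 t" if t: "t \<in> ?K" "Inf T < t" for t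
  proof -
    have tT: "t \<in> T" using t upper_kappa_subset by blast
    then have tkk: "t \<in> ?K \<inter> lower_kappa T" using t greater_Inf_lower_kappa by blast
    have T: "Inf T < Sup T" using t le_Sup[OF tT] by simp
    obtain s' where s': "has_nabla_derivative T T ?\<sigma> s' t"
      using assms(5) tkk by (auto simp: nabla_differentiable_def)
    obtain d where d: "has_nabla_derivative T ?K p d t"
      using EL(1)[OF tkk] by (auto simp: nabla_differentiable_def)
    have "d = s' *\<^sub>R q t"
      using EL(2)[OF tkk] nabla_deriv_eqI[OF s' t upper_kappa_subset] nabla_deriv_eqI[OF d t order_refl] by simp
    moreover obtain W where "has_delta_derivative T (\<lambda>s. ?w (u s)) W t" "q t \<bullet> ?w (u t) + p t \<bullet> W = 0"
      using infinitesimal_invariance[OF assms(6,4) t(1) T, of u] u_diff t assms(7) u tkk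
      unfolding invariant_under_def p_def q_def by blast
    ultimately show ?thesis
      using conserved_quantity_nabla_zero[where g = "\<lambda>s. ?w (u s)", of p s' "q t" t W] d s' t \<sigma>_cont cont
      by (auto simp: continuous_on_eq_continuous_within)
  qed
  from nabla_zero_imp_constant[OF cont this]
  show "\<exists>c. \<forall>t\<in>?K. dL_dv L (u t) (delta_deriv T u t) t \<bullet> ?w (u (?\<sigma> t)) = c"
    unfolding p_def by blast
qed

end
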